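(* There is an algorithm that, given an $n$-vertex graph $G$ and a number $k$, lists all maximal independent sets of $G$ of size smaller than $k$ in time $O(3^{4k-n}4^{n-3k})$.
   Context: An independent set is a set of pairwise nonadjacent vertices; it is maximal if it is not properly contained in another independent set of $G$. The model of computation is the unit-cost RAM: a single memory cell can hold an integer large enough to index the program's memory (in particular $n$-bit integers), and arithmetic and array-indexing operations on such values take constant time. *)

theory Defs
  imports Complex_Main "HOL-Library.Nat_Bijection"
begin

definition simple_graph :: "nat \<Rightarrow> nat set set \<Rightarrow> bool" where
  "simple_graph n E \<longleftrightarrow> (\<forall>e\<in>E. \<exists>u v. u < n \<and> v < n \<and> u \<noteq> v \<and> e = {u, v})"

definition independent_set :: "nat \<Rightarrow> nat set set \<Rightarrow> nat set \<Rightarrow> bool" where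
  "independent_set n E I \<longleftrightarrow> I \<subseteq> {..<n} \<and> pairwise (\<lambda>u v. {u, v} \<notin> E) I"

definition maximal_independent_set :: "nat \<Rightarrow> nat set set \<Rightarrow> nat set \<Rightarrow> bool" where
  "maximal_independent_set n E I \<longleftrightarrow>
     independent_set n E I \<and> \<not> (\<exists>J. independent_set n E J \<and> I \<subset> J)"

text \<open>
  A unit-cost RAM with words of \<open>w\<close> bits has registers, which are named directly by the instructions, and a memory, which is
  addressed indirectly by the contents of registers. All of these cells hold natural numbers
  below \<open>2 ^ w\<close>, and arithmetic is modulo \<open>2 ^ w\<close>. Bounding the word size is essential: with
  unbounded integers, unit-cost multiplication would be unrealistically powerful. An
  algorithm is one program that works for every \<open>w\<close> from some \<open>O(n)\<close> bound on, as long as the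
  input fits into words. There are no bitwise Boolean instructions. \<open>Emit\<close> appends one word to a write-only output.
\<close>

datatype arith_op = Add | Sub | Mult | Div | Mod

datatype instr =
    Const nat nat               \<comment> \<open>target register, literal\<close>
  | Copy nat nat                \<comment> \<open>target register, source register\<close>
  | Arith arith_op nat nat nat  \<comment> \<open>target register, operand registers\<close>
  | Load nat nat                \<comment> \<open>target register, register holding the address\<close>
  | Store nat nat               \<comment> \<open>register holding the address, source register\<close>
  | Jump nat
  | JumpIfZero nat nat          \<comment> \<open>tested register, jump target\<close>
  | JumpIfLess nat nat nat      \<comment> \<open>compared registers, jump target\<close>
  | Emit nat

record config =
  pc :: nat
  reg :: "nat \<Rightarrow> nat"
  mem :: "nat \<Rightarrow> nat"
  out :: "nat list"

text \<open>
  On words \<open>x\<close> and \<open>y\<close> the natural-number subtraction below never truncates. Division by zero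
  follows the usual convention of the library.
\<close>

fun arith :: "nat \<Rightarrow> arith_op \<Rightarrow> nat \<Rightarrow> nat \<Rightarrow> nat" where
  "arith w Add x y = (x + y) mod 2 ^ w"
| "arith w Sub x y = (2 ^ w + x - y) mod 2 ^ w"
| "arith w Mult x y = (x * y) mod 2 ^ w"
| "arith w Div x y = x div y"
| "arith w Mod x y = x mod y"

fun exec_instr :: "nat \<Rightarrow> instr \<Rightarrow> config \<Rightarrow> config" where
  "exec_instr w (Const r a) c = c\<lparr>pc := pc c + 1, reg := (reg c)(r := a mod 2 ^ w)\<rparr>"
| "exec_instr w (Copy r s) c = c\<lparr>pc := pc c + 1, reg := (reg c)(r := reg c s)\<rparr>"
| "exec_instr w (Arith f r s t) c =
     c\<lparr>pc := pc c + 1, reg := (reg c)(r := arith w f (reg c s) (reg c t))\<rparr>"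
| "exec_instr w (Load r s) c = c\<lparr>pc := pc c + 1, reg := (reg c)(r := mem c (reg c s))\<rparr>"
| "exec_instr w (Store r s) c = c\<lparr>pc := pc c + 1, mem := (mem c)(reg c r := reg c s)\<rparr>"
| "exec_instr w (Jump l) c = c\<lparr>pc := l\<rparr>"
| "exec_instr w (JumpIfZero r l) c = c\<lparr>pc := (if reg c r = 0 then l else pc c + 1)\<rparr>"
| "exec_instr w (JumpIfLess r s l) c =
     c\<lparr>pc := (if reg c r < reg c s then l else pc c + 1)\<rparr>"
| "exec_instr w (Emit r) c = c\<lparr>pc := pc c + 1, out := out c @ [reg c r]\<rparr>"

text \<open>A program halts by moving the program counter outside of the program.\<close>

definition halted :: "instr list \<Rightarrow> config \<Rightarrow> bool" where
  "halted P c \<longleftrightarrow> length P \<le> pc c"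

definition step :: "nat \<Rightarrow> instr list \<Rightarrow> config \<Rightarrow> config" where
  "step w P c = (if halted P c then c else exec_instr w (P ! pc c) c)"

definition run :: "nat \<Rightarrow> instr list \<Rightarrow> nat \<Rightarrow> config \<Rightarrow> config" where
  "run w P t = step w P ^^ t"

text \<open>
  The input is \<open>n\<close> and \<open>k\<close> in registers \<open>0\<close> and \<open>1\<close>, and the adjacency matrix, in row-major
  order, in the memory cells below \<open>n * n\<close>. All other cells are zero.
\<close>

definition input_config :: "nat \<Rightarrow> nat set set \<Rightarrow> nat \<Rightarrow> config" where
  "input_config n E k =
     \<lparr>pc = 0,
      reg = (\<lambda>_. 0)(0 := n, 1 := k),
      mem = (\<lambda>a. if a < n * n \<and> {a div n, a mod n} \<in> E then 1 else 0),
      out = []\<rparr>"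

text \<open>
  A list of words enumerates a family of finite vertex sets, without repetition, if each set \<open>I\<close>
  occurs exactly once as the integer \<open>set_encode I\<close>, whose bit \<open>v\<close> is set iff \<open>v \<in> I\<close>. For
  vertices below \<open>n\<close> this is an \<open>n\<close>-bit integer, so one set takes one word of output.
\<close>

definition enumerates :: "nat list \<Rightarrow> nat set set \<Rightarrow> bool" where
  "enumerates xs F \<longleftrightarrow> distinct xs \<and> set xs = set_encode ` F"

end

theory Submission
  imports Defs
begin

text \<open>
  Let \<open>v\<close> have minimum degree in the current induced subgraph. Every maximal independent set contains
  a vertex \<open>u\<close> of the closed neighbourhood of \<open>v\<close>, and deleting \<open>u\<close> from it leaves a maximal
  independent set of the subgraph without the closed neighbourhood of \<open>u\<close>. With \<open>d\<close> the size of the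
  closed neighbourhood of \<open>v\<close>, this gives \<open>d\<close> subproblems with at most \<open>m - d\<close> of the \<open>m\<close> vertices
  and a size budget smaller by one. As \<open>d * (3/4) ^ d \<le> 81/64\<close> for all \<open>d\<close>, the weight
  \<open>(4/3) ^ m * (81/64) ^ r\<close> of a subproblem with \<open>m\<close> vertices and budget \<open>r\<close> is at least the total
  weight of its children. The work at a subproblem is \<open>O(m\<^sup>2)\<close>, hence \<open>O((4/3) ^ m)\<close>, which is
  geometrically small against the weight when summed over the budgets, so no polynomial factor
  remains. A set may be found several times; a table of \<open>2 ^ n\<close> flags, zero from the start and thus
  free of charge, suppresses the repetitions. The subproblems wait in a queue.
\<close>

section \<open>A structured language and its compilation to RAM code\<close>

datatype com =
    Block "instr list"
  | Seq com com (infixr ";;" 60)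
  | IfLess nat nat com com
  | WhileLess nat nat com

text \<open>Jump targets are absolute, so the address \<open>i\<close> of the first instruction is
  passed along. A successful comparison jumps; hence the else branch comes first and is left by a
  jump. The overhead is one step for the then branch, two for the else branch, and two for each
  iteration and for the exit of a loop.\<close>

fun compile :: "nat \<Rightarrow> com \<Rightarrow> instr list" where
  "compile i (Block is) = is"
| "compile i (c ;; d) = (let p = compile i c in p @ compile (i + length p) d)"
| "compile i (IfLess r s c d) =
     (let q = compile (i + 1) d; j = i + length q + 2; p = compile j c
      in JumpIfLess r s j # q @ Jump (j + length p) # p)"
| "compile i (WhileLess r s c) =
     (let p = compile (i + 2) c
      in JumpIfLess r s (i + 2) # Jump (i + length p + 3) # p @ [Jump i])"

fun straight :: "instr \<Rightarrow> bool" where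
  "straight (Jump l) = False"
| "straight (JumpIfZero r l) = False"
| "straight (JumpIfLess r s l) = False"
| "straight _ = True"

text \<open>The program counter in the resulting configuration is meaningless; \<open>run_compile\<close> overrides it.\<close>

inductive exec :: "nat \<Rightarrow> com \<Rightarrow> config \<Rightarrow> nat \<Rightarrow> config \<Rightarrow> bool" for w where
  Block: "list_all straight is \<Longrightarrow> exec w (Block is) s (length is) (fold (exec_instr w) is s)"
| Seq: "exec w c s t s' \<Longrightarrow> exec w d s' t' s'' \<Longrightarrow> exec w (c ;; d) s (t + t') s''"
| IfTrue: "reg s x < reg s y \<Longrightarrow> exec w c s t s' \<Longrightarrow> exec w (IfLess x y c d) s (t + 1) s'"
| IfFalse: "\<not> reg s x < reg s y \<Longrightarrow> exec w d s t s' \<Longrightarrow> exec w (IfLess x y c d) s (t + 2) s'"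
| WhileTrue: "reg s x < reg s y \<Longrightarrow> exec w c s t s' \<Longrightarrow> exec w (WhileLess x y c) s' t' s''
    \<Longrightarrow> exec w (WhileLess x y c) s (t + t' + 2) s''"
| WhileFalse: "\<not> reg s x < reg s y \<Longrightarrow> exec w (WhileLess x y c) s 2 s"

definition code_at :: "instr list \<Rightarrow> nat \<Rightarrow> instr list \<Rightarrow> bool" where
  "code_at P i xs \<longleftrightarrow> (\<exists>as bs. P = as @ xs @ bs \<and> length as = i)"

lemma code_at_append:
  "code_at P i (xs @ ys) \<longleftrightarrow> code_at P i xs \<and> code_at P (i + length xs) ys"
proof
  assume "code_at P i (xs @ ys)"
  then obtain as bs where *: "P = as @ (xs @ ys) @ bs" "length as = i"
    unfolding code_at_def by blast
  then have "P = as @ xs @ (ys @ bs)" "P = (as @ xs) @ ys @ bs" by simp_all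
  with *(2) show "code_at P i xs \<and> code_at P (i + length xs) ys"
    unfolding code_at_def by (metis length_append)
next
  assume "code_at P i xs \<and> code_at P (i + length xs) ys"
  then obtain as bs cs ds where *: "P = as @ xs @ bs" "length as = i"
    "P = cs @ ys @ ds" "length cs = i + length xs" unfolding code_at_def by blast
  then have "cs = as @ xs"
    by (metis append_assoc append_eq_append_conv length_append)
  with * show "code_at P i (xs @ ys)" unfolding code_at_def by (metis append_assoc)
qed

lemma code_at_Cons:
  "code_at P i (x # xs) \<longleftrightarrow> i < length P \<and> P ! i = x \<and> code_at P (Suc i) xs"
proof -
  have "code_at P i [x]" if "i < length P" "P ! i = x"
    unfolding code_at_def using that id_take_nth_drop[of i P]
    by (intro exI[of _ "take i P"] exI[of _ "drop (Suc i) P"]) simp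
  then have "code_at P i [x] \<longleftrightarrow> i < length P \<and> P ! i = x"
    unfolding code_at_def by auto
  then show ?thesis using code_at_append[of P i "[x]" xs] by simp
qed

lemma run_0 [simp]: "run w P 0 s = s"
  and run_Suc: "run w P (Suc t) s = run w P t (step w P s)"
  and run_add: "run w P (t + t') s = run w P t' (run w P t s)"
  by (simp_all add: run_def funpow_swap1 add.commute[of t] funpow_add)

lemma step_code_at:
  assumes "code_at P i (x # xs)"
  shows "step w P (s\<lparr>pc := i\<rparr>) = exec_instr w x (s\<lparr>pc := i\<rparr>)"
  using assms by (simp add: step_def halted_def code_at_Cons)

lemma exec_instr_straight:
  assumes "straight x"
  shows "exec_instr w x (s\<lparr>pc := i\<rparr>) = (exec_instr w x s)\<lparr>pc := Suc i\<rparr>"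
  using assms by (cases x) simp_all

lemma run_straight:
  assumes "list_all straight is" "code_at P i is"
  shows "run w P (length is) (s\<lparr>pc := i\<rparr>) = (fold (exec_instr w) is s)\<lparr>pc := i + length is\<rparr>"
  using assms
proof (induction "is" arbitrary: i s)
  case (Cons x xs)
  have "step w P (s\<lparr>pc := i\<rparr>) = (exec_instr w x s)\<lparr>pc := Suc i\<rparr>"
    using Cons.prems by (simp add: step_code_at exec_instr_straight)
  with Cons show ?case by (simp add: run_Suc code_at_Cons)
qed simp

text \<open>The code may sit anywhere inside \<open>P\<close>, so that the induction on
  \<open>exec\<close> covers subcommands at their own addresses.\<close>

lemma run_compile:
  assumes "exec w c s t s'" "code_at P i (compile i c)"
  shows "run w P t (s\<lparr>pc := i\<rparr>) = s'\<lparr>pc := i + length (compile i c)\<rparr>"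
  using assms
proof (induction arbitrary: i)
  case (Block "is" s)
  then show ?case by (simp add: run_straight)
next
  case (Seq c s t s' d t' s'')
  then show ?case by (simp add: Let_def code_at_append run_add add.assoc)
next
  case (IfTrue s x y c t s' d)
  let ?j = "i + length (compile (Suc i) d) + 2"
  have code: "code_at P ?j (compile ?j c)"
    using IfTrue.prems by (simp add: Let_def code_at_append code_at_Cons)
  have "step w P (s\<lparr>pc := i\<rparr>) = s\<lparr>pc := ?j\<rparr>"
    using IfTrue.prems IfTrue.hyps(1) by (simp add: Let_def step_code_at)
  with IfTrue.IH[OF code] show ?case by (simp add: run_Suc Let_def add_ac)
next
  case (IfFalse s x y d t s' c)
  let ?j = "i + length (compile (Suc i) d) + 1"
  have code: "code_at P (Suc i) (compile (Suc i) d)"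
    "code_at P ?j (Jump (?j + 1 + length (compile (Suc ?j) c)) # compile (Suc ?j) c)"
    using IfFalse.prems by (simp_all add: Let_def code_at_append code_at_Cons)
  have "step w P (s\<lparr>pc := i\<rparr>) = s\<lparr>pc := Suc i\<rparr>"
    using IfFalse.prems IfFalse.hyps(1) by (simp add: Let_def step_code_at)
  moreover have "run w P t (s\<lparr>pc := Suc i\<rparr>) = s'\<lparr>pc := ?j\<rparr>"
    using IfFalse.IH[OF code(1)] by simp
  ultimately have "run w P (Suc t + 1) (s\<lparr>pc := i\<rparr>) = step w P (s'\<lparr>pc := ?j\<rparr>)"
    by (simp only: run_add run_Suc run_0 One_nat_def)
  then have "run w P (t + 2) (s\<lparr>pc := i\<rparr>) = s'\<lparr>pc := ?j + 1 + length (compile (Suc ?j) c)\<rparr>"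
    unfolding step_code_at[OF code(2)] by simp
  then show ?case by (simp add: Let_def add_ac)
next
  case (WhileTrue s x y c t s' t' s'')
  let ?p = "compile (i + 2) c"
  have code: "code_at P (i + 2) ?p" "code_at P (i + 2 + length ?p) [Jump i]"
    using WhileTrue.prems by (simp_all add: Let_def code_at_append code_at_Cons)
  have "step w P (s\<lparr>pc := i\<rparr>) = s\<lparr>pc := i + 2\<rparr>"
    using WhileTrue.prems WhileTrue.hyps(1) by (simp add: Let_def step_code_at)
  moreover have "run w P t (s\<lparr>pc := i + 2\<rparr>) = s'\<lparr>pc := i + 2 + length ?p\<rparr>"
    using WhileTrue.IH(1)[OF code(1)] by simp
  moreover have "step w P (s'\<lparr>pc := i + 2 + length ?p\<rparr>) = s'\<lparr>pc := i\<rparr>"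
    unfolding step_code_at[OF code(2)] by simp
  ultimately have "run w P (Suc t + (Suc t')) (s\<lparr>pc := i\<rparr>) = run w P t' (s'\<lparr>pc := i\<rparr>)"
    by (simp only: run_add run_Suc)
  then show ?case using WhileTrue.IH(2)[OF WhileTrue.prems] by simp
next
  case (WhileFalse s x y c)
  let ?p = "compile (i + 2) c"
  have code: "code_at P i (JumpIfLess x y (i + 2) # Jump (i + length ?p + 3) # ?p @ [Jump i])"
    "code_at P (Suc i) (Jump (i + length ?p + 3) # ?p @ [Jump i])"
    using WhileFalse.prems by (simp_all add: Let_def code_at_Cons)
  have "run w P (Suc (Suc 0)) (s\<lparr>pc := i\<rparr>) = s\<lparr>pc := i + length ?p + 3\<rparr>"
    using WhileFalse.hyps unfolding run_Suc by (simp add: step_code_at[OF code(1)] step_code_at[OF code(2)])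
  then show ?case by (simp add: Let_def numeral_2_eq_2)
qed

section \<open>Total correctness with step counts\<close>

definition wp :: "nat \<Rightarrow> com \<Rightarrow> (nat \<Rightarrow> config \<Rightarrow> bool) \<Rightarrow> config \<Rightarrow> bool" where
  "wp w c Q s \<longleftrightarrow> (\<exists>t s'. exec w c s t s' \<and> Q t s')"

inductive_cases exec_BlockE: "exec w (Block is) s t s'"
inductive_cases exec_SeqE: "exec w (c ;; d) s t s'"
inductive_cases exec_IfE: "exec w (IfLess x y c d) s t s'"

lemma wp_Block [simp]:
  "wp w (Block is) Q s \<longleftrightarrow> list_all straight is \<and> Q (length is) (fold (exec_instr w) is s)"
  unfolding wp_def by (blast intro: exec.intros elim: exec_BlockE)

lemma wp_Seq [simp]: "wp w (c ;; d) Q s \<longleftrightarrow> wp w c (\<lambda>t. wp w d (\<lambda>t'. Q (t + t'))) s"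
  unfolding wp_def by (blast intro: exec.intros elim: exec_SeqE)

lemma wp_IfLess [simp]:
  "wp w (IfLess x y c d) Q s \<longleftrightarrow>
     (if reg s x < reg s y then wp w c (\<lambda>t. Q (t + 1)) s else wp w d (\<lambda>t. Q (t + 2)) s)"
  unfolding wp_def by (auto elim!: exec_IfE) (metis exec.IfTrue exec.IfFalse Suc_eq_plus1 add_2_eq_Suc')+

lemma wp_mono:
  assumes "wp w c Q s" "\<And>t s'. Q t s' \<Longrightarrow> Q' t s'"
  shows "wp w c Q' s"
  using assms unfolding wp_def by blast

lemma wp_WhileLess_False:
  assumes "\<not> reg s x < reg s y" "Q 2 s"
  shows "wp w (WhileLess x y c) Q s"
  using assms unfolding wp_def by (blast intro: exec.intros)

lemma wp_WhileLess_True: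
  assumes "reg s x < reg s y" "wp w c (\<lambda>t. wp w (WhileLess x y c) (\<lambda>t'. Q (t + t' + 2))) s"
  shows "wp w (WhileLess x y c) Q s"
  using assms unfolding wp_def by (blast intro: exec.intros)

text \<open>This serves loops whose number \<open>m\<close> of iterations is known in advance. An
  iteration costs at most \<open>T\<close> plus 2 for the test and the back jump; the failing test
  and the exit jump cost the final 2. The induction is on the remaining iterations
  \<open>m - j\<close>.\<close>

lemma wp_for:
  assumes init: "I 0 s"
    and step: "\<And>j s. j < m \<Longrightarrow> I j s \<Longrightarrow>
      reg s x < reg s y \<and> wp w c (\<lambda>t s'. t \<le> T \<and> I (Suc j) s') s"
    and final: "\<And>s. I m s \<Longrightarrow> \<not> reg s x < reg s y"
    and post: "\<And>t s. t \<le> m * (T + 2) + 2 \<Longrightarrow> I m s \<Longrightarrow> Q t s"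
  shows "wp w (WhileLess x y c) Q s"
proof -
  have "wp w (WhileLess x y c) (\<lambda>t s'. t \<le> (m - j) * (T + 2) + 2 \<and> I m s') s"
    if "j \<le> m" "I j s" for j s
    using that
  proof (induction "m - j" arbitrary: j s)
    case 0
    then show ?case using final by (auto intro!: wp_WhileLess_False)
  next
    case (Suc d)
    then have j: "j < m" and d: "d = m - Suc j" by simp_all
    have le: "t + t' + 2 \<le> (m - j) * (T + 2) + 2"
      if "t \<le> T" "t' \<le> (m - Suc j) * (T + 2) + 2" for t t'
      using that j by (simp add: Suc_diff_Suc[symmetric])
    note step = step[OF j Suc.prems(2)]
    show ?case
    proof (rule wp_WhileLess_True[OF conjunct1[OF step]], rule wp_mono[OF conjunct2[OF step]])
      fix t s' assume t: "t \<le> T \<and> I (Suc j) s'"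
      have "wp w (WhileLess x y c) (\<lambda>t' s''. t' \<le> (m - Suc j) * (T + 2) + 2 \<and> I m s'') s'"
        using Suc.hyps(1)[OF d _ conjunct2[OF t]] j by simp
      then show "wp w (WhileLess x y c)
          (\<lambda>t' s''. t + t' + 2 \<le> (m - j) * (T + 2) + 2 \<and> I m s'') s'"
        by (rule wp_mono) (use t le in blast)
    qed
  qed
  from this[OF le0 init] show ?thesis by (rule wp_mono) (simp add: post)
qed

section \<open>Maximal independent sets as independent dominating sets\<close>

definition near :: "nat set set \<Rightarrow> nat \<Rightarrow> nat \<Rightarrow> bool" where
  "near E u v \<longleftrightarrow> u = v \<or> {u, v} \<in> E"

lemma near_refl [simp]: "near E u u"
  and near_sym: "near E u v \<longleftrightarrow> near E v u"
  by (auto simp: near_def insert_commute)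

text \<open>Domination replaces maximality, so that \<open>S\<close> can be shrunk without any
  mention of larger independent sets.\<close>

definition mis :: "nat set set \<Rightarrow> nat set \<Rightarrow> nat set \<Rightarrow> bool" where
  "mis E S J \<longleftrightarrow> J \<subseteq> S \<and> (\<forall>u\<in>J. \<forall>v\<in>J. near E u v \<longrightarrow> u = v) \<and> (\<forall>x\<in>S. \<exists>y\<in>J. near E y x)"

text \<open>An undominated vertex could be added to \<open>I\<close>. Conversely, a new vertex of a
  larger independent set would be near some member of \<open>I\<close>, which also belongs to the
  larger set.\<close>

lemma maximal_independent_set_iff_mis:
  "maximal_independent_set n E I \<longleftrightarrow> mis E {..<n} I"
proof
  assume I: "maximal_independent_set n E I"
  have "\<exists>y\<in>I. near E y x" if "x < n" for x
  proof (rule ccontr)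
    assume *: "\<not> (\<exists>y\<in>I. near E y x)"
    then have "{y, x} \<notin> E \<and> {x, y} \<notin> E" if "y \<in> I" for y
      using * that by (simp add: near_def insert_commute[of x])
    then have "independent_set n E (insert x I)"
      using conjunct1[OF I[unfolded maximal_independent_set_def]] \<open>x < n\<close>
      unfolding independent_set_def
      by (simp add: pairwise_insert)
    moreover have "I \<subset> insert x I" using * near_refl[of E x] by blast
    ultimately show False using I unfolding maximal_independent_set_def by blast
  qed
  then show "mis E {..<n} I"
    using conjunct1[OF I[unfolded maximal_independent_set_def]]
    unfolding mis_def independent_set_def pairwise_def near_def by blast
next
  assume I: "mis E {..<n} I"
  have "\<not> I \<subset> J" if J: "independent_set n E J" for J
  proof
    assume "I \<subset> J"
    then obtain x where x: "x \<in> J" "x \<notin> I" by blast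
    then obtain y where "y \<in> I" "near E y x"
      using I J unfolding mis_def independent_set_def by blast
    moreover have "y \<in> J" "y \<noteq> x" using \<open>y \<in> I\<close> \<open>I \<subset> J\<close> x by auto
    moreover from J have "pairwise (\<lambda>u v. {u, v} \<notin> E) J" by (simp add: independent_set_def)
    ultimately show False using pairwiseD x(1) unfolding near_def by metis
  qed
  moreover have "independent_set n E I"
    using I unfolding mis_def independent_set_def pairwise_def near_def by blast
  ultimately show "maximal_independent_set n E I"
    unfolding maximal_independent_set_def by blast
qed

text \<open>Some \<open>u\<close> in \<open>J\<close> dominates \<open>v\<close>. No other member of
  \<open>J\<close> lies in the closed neighbourhood of \<open>u\<close>, and \<open>u\<close>
  dominates nothing outside it, so \<open>J - {u}\<close> dominates the rest. Conversely,
  \<open>u\<close> dominates precisely the deleted vertices.\<close>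

lemma mis_branch:
  assumes "v \<in> S"
  shows "mis E S J \<longleftrightarrow> (\<exists>u\<in>S. near E v u \<and> (\<exists>J'. mis E {x\<in>S. \<not> near E u x} J' \<and> J = insert u J'))"
proof
  assume J: "mis E S J"
  then obtain u where u: "u \<in> J" "near E u v" using assms by (auto simp: mis_def)
  have "mis E {x\<in>S. \<not> near E u x} (J - {u})"
    unfolding mis_def
  proof (intro conjI)
    show "J - {u} \<subseteq> {x \<in> S. \<not> near E u x}" using J u by (auto simp: mis_def)
    show "\<forall>x\<in>{x \<in> S. \<not> near E u x}. \<exists>y\<in>J - {u}. near E y x"
      using J u unfolding mis_def by blast
  qed (use J in \<open>auto simp: mis_def\<close>)
  moreover have "J = insert u (J - {u})" "u \<in> S" using u J by (auto simp: mis_def)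
  ultimately show "\<exists>u\<in>S. near E v u \<and> (\<exists>J'. mis E {x\<in>S. \<not> near E u x} J' \<and> J = insert u J')"
    using u near_sym by blast
next
  assume "\<exists>u\<in>S. near E v u \<and> (\<exists>J'. mis E {x\<in>S. \<not> near E u x} J' \<and> J = insert u J')"
  then obtain u J' where *: "u \<in> S" "mis E {x\<in>S. \<not> near E u x} J'" "J = insert u J'" by blast
  then show "mis E S J" unfolding mis_def using near_sym[of E u] by auto
qed

section \<open>Subproblems and branching\<close>

type_synonym task = "nat list \<times> nat \<times> nat"

text \<open>
  A task \<open>(xs, c, r)\<close> asks for all sets of code \<open>c + set_encode J\<close> where \<open>J\<close> is a maximal
  independent set of the subgraph induced by \<open>xs\<close> with fewer than \<open>r\<close> vertices.
\<close>

fun solutions :: "nat set set \<Rightarrow> task \<Rightarrow> nat set" where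
  "solutions E (xs, c, r) = {c + set_encode J | J. mis E (set xs) J \<and> card J < r}"

definition child :: "nat set set \<Rightarrow> task \<Rightarrow> nat \<Rightarrow> task" where
  "child E = (\<lambda>(xs, c, r) u. (filter (\<lambda>x. \<not> near E u x) xs, c + 2 ^ u, r - 1))"

definition children :: "nat set set \<Rightarrow> task \<Rightarrow> nat \<Rightarrow> task list" where
  "children E t v = map (child E t) (filter (near E v) (fst t))"

text \<open>As \<open>near\<close> is reflexive, \<open>u\<close> is absent from the remaining
  graph; inserting it therefore adds \<open>2 ^ u\<close> to the code and 1 to the cardinality.
  Children may share solutions, so the union need not be disjoint.\<close>

lemma solutions_children:
  assumes "v \<in> set xs" "r > 0"
  shows "solutions E (xs, c, r) = (\<Union>t\<in>set (children E (xs, c, r) v). solutions E t)"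
proof -
  have ins: "c + set_encode (insert u J) = c + 2 ^ u + set_encode J"
    "card (insert u J) = Suc (card J)"
    if "mis E {x \<in> set xs. \<not> near E u x} J" for u J
  proof -
    have "u \<notin> J" "J \<subseteq> set xs" using that by (auto simp: mis_def)
    moreover from this have "finite J" using finite_subset by blast
    ultimately show "c + set_encode (insert u J) = c + 2 ^ u + set_encode J"
      "card (insert u J) = Suc (card J)" by simp_all
  qed
  have "y \<in> solutions E (xs, c, r) \<longleftrightarrow>
      (\<exists>u\<in>set xs. near E v u \<and> (\<exists>J. mis E {x \<in> set xs. \<not> near E u x} J \<and>
        y = c + set_encode (insert u J) \<and> card (insert u J) < r))" for y
    by (auto simp: mis_branch[OF assms(1)])
  also have "\<dots> y \<longleftrightarrow> (\<exists>u\<in>set xs. near E v u \<and> (\<exists>J. mis E {x \<in> set xs. \<not> near E u x} J \<and>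
        y = c + 2 ^ u + set_encode J \<and> card J < r - 1))" for y
    by (simp add: ins less_diff_conv cong: conj_cong)
  finally show ?thesis by (auto simp: children_def child_def)
qed

lemma solutions_Nil: "r > 0 \<Longrightarrow> solutions E ([], c, r) = {c}"
  by (auto simp: mis_def)

section \<open>Bounds on space and time for a task with all its descendants\<close>

definition deg :: "nat set set \<Rightarrow> nat list \<Rightarrow> nat \<Rightarrow> nat" where
  "deg E xs v = length (filter (near E v) xs)"

lemma length_child: "length (fst (child E (xs, c, r) u)) = length xs - deg E xs u"
  using sum_length_filter_compl[of "near E u" xs] by (simp add: child_def deg_def)

lemma deg_le: "deg E xs v \<le> length xs"
  by (simp add: deg_def)

text \<open>The queue is never reclaimed: this bounds the cells used by a task and all its descendants.\<close>

definition space :: "task \<Rightarrow> nat" where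
  "space t = 4 * 4 ^ length (fst t)"

text \<open>There are \<open>deg E xs v\<close> children, and by minimality each of them loses at
  least that many vertices. A general monotone \<open>f\<close> serves both the space and the time
  estimate.\<close>

lemma sum_list_children_le:
  fixes f :: "nat \<Rightarrow> real"
  assumes min: "\<And>u. u \<in> set xs \<Longrightarrow> deg E xs v \<le> deg E xs u" and "mono f"
  shows "(\<Sum>t\<leftarrow>children E (xs, c, r) v. f (length (fst t)))
    \<le> deg E xs v * f (length xs - deg E xs v)"
proof -
  have "(\<Sum>t\<leftarrow>children E (xs, c, r) v. f (length (fst t)))
      = (\<Sum>u\<leftarrow>filter (near E v) xs. f (length xs - deg E xs u))"
    by (simp add: children_def o_def length_child)
  also have "\<dots> \<le> (\<Sum>u\<leftarrow>filter (near E v) xs. f (length xs - deg E xs v))"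
    using min by (intro sum_list_mono monoD[OF \<open>mono f\<close>] diff_le_mono2) auto
  finally show ?thesis by (simp add: sum_list_triv deg_def)
qed

lemma four_mult_le_power: "4 * d \<le> (4::nat) ^ d"
proof (induction d)
  case (Suc d)
  then show ?case by (cases d) auto
qed simp

text \<open>With \<open>d\<close> the closed degree of \<open>v\<close> and
  \<open>m = length xs\<close>, the children need at most
  \<open>4 * d * 4 ^ (m - d) \<le> 4 ^ m\<close> cells. The remaining \<open>3 * 4 ^ m\<close> cover
  the \<open>m + 3\<close> cells of the task itself.\<close>

lemma space_children:
  assumes "\<And>u. u \<in> set xs \<Longrightarrow> deg E xs v \<le> deg E xs u"
  shows "length xs + 3 + sum_list (map space (children E (xs, c, r) v)) \<le> space (xs, c, r)"
proof -
  let ?d = "deg E xs v" and ?m = "length xs"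
  have "real (sum_list (map space ts)) = (\<Sum>t\<leftarrow>ts. 4 * 4 ^ length (fst t))" for ts
    by (induction ts) (simp_all add: space_def)
  then have "real (sum_list (map space (children E (xs, c, r) v)))
      = (\<Sum>t\<leftarrow>children E (xs, c, r) v. 4 * 4 ^ length (fst t))" .
  also have "\<dots> \<le> real ?d * (4 * 4 ^ (?m - ?d))"
    by (rule sum_list_children_le[OF assms]) (auto intro!: monoI power_increasing)
  also have "\<dots> = real (4 * ?d * 4 ^ (?m - ?d))" by simp
  also have "4 * ?d * 4 ^ (?m - ?d) \<le> 4 ^ ?d * 4 ^ (?m - ?d)"
    by (intro mult_right_mono four_mult_le_power) simp
  also have "\<dots> = 4 ^ ?m" by (simp add: power_add[symmetric] deg_le)
  finally have "sum_list (map space (children E (xs, c, r) v)) \<le> 4 ^ ?m" by simp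
  moreover have "m + 3 \<le> 3 * 4 ^ m" for m :: nat by (induction m) auto
  from this[of ?m] have "?m + 3 \<le> 3 * 4 ^ ?m" .
  ultimately show ?thesis by (simp add: space_def)
qed

text \<open>Equality holds at \<open>d = 3\<close> and \<open>d = 4\<close>, which explains the
  constant. From \<open>d = 3\<close> on, passing to \<open>d + 1\<close> multiplies the left side
  by \<open>(3 / 4) * (d + 1) / d \<le> 1\<close>; the smaller cases are computed.\<close>

lemma mult_power_le: "real d * (3 / 4) ^ d \<le> 81 / 64"
proof -
  have ge3: "real (d + 3) * (3 / 4) ^ (d + 3) \<le> 81 / 64" for d
  proof (induction d)
    case (Suc d)
    have "real (Suc d + 3) * (3 / 4) ^ (Suc d + 3)
        = (real (Suc d + 3) * (3 / 4)) * (3 / 4) ^ (d + 3)"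
      by (simp only: add_Suc power_Suc mult_ac)
    also have "\<dots> \<le> real (d + 3) * (3 / 4) ^ (d + 3)"
      by (intro mult_right_mono) auto
    finally show ?case using Suc by simp
  qed (simp add: power3_eq_cube)
  consider "d = 0" | "d = 1" | "d = 2" | "d = (d - 3) + 3" by linarith
  then show ?thesis
  proof cases
    case 4
    then show ?thesis using ge3[of "d - 3"] by (simp only: flip: 4)
  qed (simp_all add: power2_eq_square)
qed

text \<open>
  Since \<open>3 powr (4k - n) * 4 powr (n - 3k) = (4/3) ^ n * (81/64) ^ k\<close>, this is the claimed bound up to
  a constant factor; the subtracted 1 pays for the work at the task itself.
\<close>

definition potential :: "task \<Rightarrow> real" where
  "potential = (\<lambda>(xs, c, r). (4 / 3) ^ length xs * ((81 / 64) ^ Suc r - 1))"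

text \<open>The factor \<open>17 / 64 = 81 / 64 - 1\<close> is the value of the second factor of the
  potential at budget 0, its minimum.\<close>

lemma potential_ge: "(4 / 3) ^ length xs * (17 / 64) \<le> potential (xs, c, r)"
proof -
  have "(81 / 64) ^ Suc 0 \<le> (81 / 64 :: real) ^ Suc r" by (intro power_increasing) auto
  then show ?thesis unfolding potential_def by simp
qed

text \<open>With \<open>a = (4 / 3) ^ length xs\<close> and \<open>q = 81 / 64\<close>, the children
  have total potential at most \<open>q * a * (q ^ r - 1)\<close>. This falls short of
  \<open>a * (q ^ Suc r - 1)\<close> by \<open>a * (q - 1)\<close>, the share left for the task
  itself.\<close>

lemma potential_children:
  assumes min: "\<And>u. u \<in> set xs \<Longrightarrow> deg E xs v \<le> deg E xs u" and "r > 0"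
  shows "(4 / 3) ^ length xs * (17 / 64) + sum_list (map potential (children E (xs, c, r) v))
    \<le> potential (xs, c, r)"
proof -
  let ?d = "deg E xs v" and ?m = "length xs" and ?q = "81 / 64 :: real"
  have q: "0 \<le> ?q ^ r - 1" using one_le_power[of ?q r] by simp
  \<comment> \<open>A child has budget \<open>r - 1\<close>, so its exponent
    \<open>Suc (r - 1)\<close> is \<open>r\<close>.\<close>
  have "sum_list (map potential (children E (xs, c, r) v))
      = (\<Sum>t\<leftarrow>children E (xs, c, r) v. (4 / 3) ^ length (fst t) * (?q ^ r - 1))"
    using \<open>r > 0\<close> by (simp add: potential_def children_def child_def o_def flip: power_Suc)
  also have "\<dots> \<le> ?d * ((4 / 3) ^ (?m - ?d) * (?q ^ r - 1))"
    by (rule sum_list_children_le[OF min]) (auto intro!: monoI mult_right_mono power_increasing q)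
  also have "\<dots> = (?d * (3 / 4) ^ ?d) * ((4 / 3) ^ ?m * (?q ^ r - 1))"
  proof -
    have "(4 / 3 :: real) ^ ?m = (4 / 3) ^ (?m - ?d) * (4 / 3) ^ ?d"
      by (simp add: deg_le flip: power_add)
    then show ?thesis by (simp add: power_divide)
  qed
  also have "\<dots> \<le> ?q * ((4 / 3) ^ ?m * (?q ^ r - 1))"
    using q by (intro mult_right_mono mult_power_le) auto
  finally show ?thesis by (simp add: potential_def algebra_simps)
qed

section \<open>Memory segments and the layout of the queue\<close>

definition segment :: "(nat \<Rightarrow> nat) \<Rightarrow> nat \<Rightarrow> nat list \<Rightarrow> bool" where
  "segment M a ys \<longleftrightarrow> (\<forall>i<length ys. M (a + i) = ys ! i)"

lemma segment_nth: "segment M a ys \<Longrightarrow> i < length ys \<Longrightarrow> M (a + i) = ys ! i"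
  by (simp add: segment_def)

lemma segment_append:
  "segment M a (ys @ zs) \<longleftrightarrow> segment M a ys \<and> segment M (a + length ys) zs"
proof -
  have "(\<forall>i<length ys + length zs. M (a + i) = (ys @ zs) ! i) \<longleftrightarrow>
    (\<forall>i<length ys. M (a + i) = ys ! i) \<and> (\<forall>i<length zs. M (a + (length ys + i)) = zs ! i)"
    (is "?L \<longleftrightarrow> ?R")
  proof
    assume L: ?L
    have "M (a + (length ys + i)) = zs ! i" if "i < length zs" for i
      using L[rule_format, of "length ys + i"] that by simp
    with L show ?R by (auto simp: nth_append)
  next
    assume R: ?R
    show ?L
    proof (intro allI impI)
      fix i assume "i < length ys + length zs"
      then show "M (a + i) = (ys @ zs) ! i"
        using R[THEN conjunct1, rule_format, of i] R[THEN conjunct2, rule_format, of "i - length ys"]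
        by (cases "i < length ys") (auto simp: nth_append)
    qed
  qed
  then show ?thesis by (simp add: segment_def add.assoc)
qed

lemma segment_Nil [simp]: "segment M a []"
  by (simp add: segment_def)

lemma segment_Cons: "segment M a (y # ys) \<longleftrightarrow> M a = y \<and> segment M (Suc a) ys"
  using segment_append[of M a "[y]" ys] by (simp add: segment_def)

lemma segment_cong:
  assumes "segment M a ys" "\<And>b. a \<le> b \<Longrightarrow> b < a + length ys \<Longrightarrow> M' b = M b"
  shows "segment M' a ys"
  using assms by (simp add: segment_def)

text \<open>
  The tasks are kept in a queue, a task \<open>(xs, c, r)\<close> being stored as its frame. The memory is
  divided into the adjacency matrix with its diagonal set to 1, a table of the powers of 2 below
  \<open>2 ^ n\<close>, a table of \<open>2 ^ n\<close> flags for the codes that have been output, and the queue.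
\<close>

fun frame :: "task \<Rightarrow> nat list" where
  "frame (xs, c, r) = [length xs, c, r] @ xs"

definition frames :: "task list \<Rightarrow> nat list" where
  "frames ts = concat (map frame ts)"

lemma frames_simps [simp]:
  "frames [] = []" "frames (t # ts) = frame t @ frames ts" "frames (ts @ us) = frames ts @ frames us"
  by (simp_all add: frames_def)

lemma length_frame: "length (frame t) = 3 + length (fst t)"
  by (cases t) simp

section \<open>Registers and the program\<close>

abbreviation (input) "rN \<equiv> 0 :: nat"
abbreviation (input) "rK \<equiv> 1 :: nat"
abbreviation (input) "rOne \<equiv> 2 :: nat"
abbreviation (input) "rZero \<equiv> 3 :: nat"
abbreviation (input) "rPow \<equiv> 4 :: nat"
abbreviation (input) "rFlag \<equiv> 5 :: nat"
abbreviation (input) "rHead \<equiv> 6 :: nat"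
abbreviation (input) "rTail \<equiv> 7 :: nat"
abbreviation (input) "rLen \<equiv> 8 :: nat"
abbreviation (input) "rCode \<equiv> 9 :: nat"
abbreviation (input) "rBudget \<equiv> 10 :: nat"
abbreviation (input) "rList \<equiv> 11 :: nat"
abbreviation (input) "rI \<equiv> 12 :: nat"
abbreviation (input) "rJ \<equiv> 13 :: nat"
abbreviation (input) "rX \<equiv> 14 :: nat"
abbreviation (input) "rA \<equiv> 15 :: nat"
abbreviation (input) "rDeg \<equiv> 16 :: nat"
abbreviation (input) "rMin \<equiv> 17 :: nat"
abbreviation (input) "rV \<equiv> 18 :: nat"
abbreviation (input) "rRowV \<equiv> 19 :: nat"
abbreviation (input) "rU \<equiv> 20 :: nat"
abbreviation (input) "rPos \<equiv> 21 :: nat"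
abbreviation (input) "rCnt \<equiv> 22 :: nat"
abbreviation (input) "rTmp \<equiv> 23 :: nat"
abbreviation (input) "rRowU \<equiv> 24 :: nat"

definition deg_loop :: com where
  "deg_loop = WhileLess rJ rLen (Block
     [Arith Add rTmp rList rJ, Load rX rTmp,
      Arith Add rTmp rRowU rX, Load rA rTmp,
      Arith Add rDeg rDeg rA,
      Arith Add rJ rJ rOne])"

definition min_loop :: com where
  "min_loop = WhileLess rI rLen
    (Block [Arith Add rTmp rList rI, Load rU rTmp, Arith Mult rRowU rU rN, Const rDeg 0, Const rJ 0] ;;
     deg_loop ;;
     IfLess rDeg rMin (Block [Copy rMin rDeg, Copy rV rU]) (Block []) ;;
     Block [Arith Add rI rI rOne])"

definition filter_loop :: com where
  "filter_loop = WhileLess rJ rLen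
    (Block [Arith Add rTmp rList rJ, Load rX rTmp, Arith Add rTmp rRowU rX, Load rA rTmp] ;;
     IfLess rA rOne
       (Block [Store rPos rX, Arith Add rPos rPos rOne, Arith Add rCnt rCnt rOne])
       (Block []) ;;
     Block [Arith Add rJ rJ rOne])"

text \<open>The length of the new list is known only after filtering. Therefore three cells are
  skipped, the list is written behind them, and the header is filled in last.\<close>

definition push_child :: com where
  "push_child =
     Block [Arith Mult rRowU rU rN, Const rCnt 0, Arith Add rPos rTail rOne,
       Arith Add rPos rPos rOne, Arith Add rPos rPos rOne, Const rJ 0] ;;
     filter_loop ;;
     Block [Store rTail rCnt,
       Arith Add rTail rTail rOne, Arith Add rTmp rPow rU, Load rA rTmp,
       Arith Add rA rCode rA, Store rTail rA,
       Arith Add rTail rTail rOne, Arith Sub rA rBudget rOne, Store rTail rA,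
       Copy rTail rPos]"

definition push_loop :: com where
  "push_loop = WhileLess rI rLen
    (Block [Arith Add rTmp rList rI, Load rU rTmp, Arith Add rTmp rRowV rU, Load rA rTmp] ;;
     IfLess rZero rA push_child (Block []) ;;
     Block [Arith Add rI rI rOne])"

definition branch :: com where
  "branch =
     Block [Const rI 0, Arith Add rMin rLen rOne] ;;
     min_loop ;;
     Block [Arith Mult rRowV rV rN, Const rI 0] ;;
     push_loop"

definition leaf :: com where
  "leaf =
     Block [Arith Add rTmp rFlag rCode, Load rA rTmp] ;;
     IfLess rA rOne (Block [Store rTmp rOne, Emit rCode]) (Block [])"

text \<open>The head passes the frame at once; the frame stays intact, since new tasks are written
  from the tail on.\<close>

definition process :: com where
  "process =
     Block [Load rLen rHead, Arith Add rTmp rHead rOne, Load rCode rTmp,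
       Arith Add rTmp rTmp rOne, Load rBudget rTmp, Arith Add rList rTmp rOne,
       Arith Add rHead rList rLen] ;;
     IfLess rZero rBudget (IfLess rZero rLen branch leaf) (Block [])"

text \<open>The powers of 2 arise by doubling \<open>rX\<close>, which ends as \<open>2 ^ n\<close>,
  the size of the flag table, and is used as such by \<open>enqueue_root\<close>.\<close>

definition table_loop :: com where
  "table_loop = WhileLess rI rN (Block
     [Arith Mult rTmp rI rN, Arith Add rTmp rTmp rI, Store rTmp rOne,
      Arith Add rTmp rPow rI, Store rTmp rX, Arith Add rX rX rX, Arith Add rI rI rOne])"

definition list_loop :: com where
  "list_loop = WhileLess rI rN (Block
     [Store rTail rI, Arith Add rTail rTail rOne, Arith Add rI rI rOne])"

definition enqueue_root :: com where
  "enqueue_root =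
     Block [Arith Add rHead rFlag rX, Store rHead rN,
       Arith Add rTmp rHead rOne, Store rTmp rZero,
       Arith Add rTmp rTmp rOne, Store rTmp rK,
       Arith Add rTail rTmp rOne, Const rI 0] ;;
     list_loop"

text \<open>\<open>rZero\<close>, and \<open>rI\<close> on entry to \<open>table_loop\<close>, rely
  on the zeros of the input configuration.\<close>

definition prepare :: com where
  "prepare =
     Block [Const rOne 1, Arith Mult rPow rN rN, Arith Add rFlag rPow rN, Const rX 1] ;;
     table_loop ;;
     enqueue_root"

definition main :: com where
  "main = prepare ;; WhileLess rHead rTail process"

abbreviation agree :: "nat set \<Rightarrow> config \<Rightarrow> config \<Rightarrow> bool" where
  "agree A s s' \<equiv> \<forall>r. r \<notin> A \<longrightarrow> reg s' r = reg s r"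

section \<open>Arithmetic facts\<close>

lemma index_eq_iff:
  fixes u v u' v' n :: nat
  assumes "v < n" "v' < n"
  shows "u * n + v = u' * n + v' \<longleftrightarrow> u = u' \<and> v = v'"
proof
  assume *: "u * n + v = u' * n + v'"
  have "(u * n + v) div n = u" "(u' * n + v') div n = u'" using assms by simp_all
  with * show "u = u' \<and> v = v'" by auto
qed simp

text \<open>This absorbs the quadratic work at a task into the exponential weight. The ratio of
  consecutive squares is at most \<open>4 / 3\<close> from \<open>m = 6\<close> on, so the induction
  starts there and smaller values are computed.\<close>

lemma square_le_power: "(real m + 1)\<^sup>2 \<le> 9 * (4 / 3) ^ m"
proof -
  have ge: "(real (m + 6) + 1)\<^sup>2 \<le> 9 * (4 / 3) ^ (m + 6)" for m
  proof (induction m)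
    case (Suc m)
    have "(real (Suc m + 6) + 1)\<^sup>2 \<le> 4 / 3 * (real (m + 6) + 1)\<^sup>2"
      using zero_le_square[of "real m"] by (simp add: power2_eq_square field_simps)
    also have "\<dots> \<le> 4 / 3 * (9 * (4 / 3) ^ (m + 6))" using Suc by simp
    finally show ?case by (simp only: add_Suc power_Suc mult_ac)
  qed (simp add: power_divide)
  consider "m = 0" | "m = 1" | "m = 2" | "m = 3" | "m = 4" | "m = 5" | "m = (m - 6) + 6" by linarith
  then show ?thesis
  proof cases
    case 7
    then show ?thesis using ge[of "m - 6"] by (simp only: flip: 7)
  qed (simp_all add: power_divide)
qed

lemma bound_eq:
  "3 powr (4 * real k - real n) * 4 powr (real n - 3 * real k) = (4 / 3) ^ n * (81 / 64 :: real) ^ k"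
proof -
  have "3 powr (4 * real k - real n) = 81 ^ k / (3::real) ^ n"
    using powr_realpow[of "3::real" "4 * k"] by (simp add: powr_diff powr_realpow power_mult)
  moreover have "4 powr (real n - 3 * real k) = (4::real) ^ n / 64 ^ k"
    using powr_realpow[of "4::real" "3 * k"] by (simp add: powr_diff powr_realpow power_mult)
  ultimately show ?thesis by (simp add: power_divide)
qed

section \<open>Addresses that fit into words\<close>

locale word_ram =
  fixes n w :: nat and E :: "nat set set"
  assumes word_size: "3 * (n + 1) \<le> w"
begin

definition base :: nat where
  "base = n * n + n + 2 ^ n"

text \<open>The second summand is the \<open>space\<close> of the root task, which has all
  \<open>n\<close> vertices.\<close>

definition limit :: nat where
  "limit = base + 4 * 4 ^ n"

text \<open>Tables and queue together take fewer than
  \<open>8 * 4 ^ n \<le> 2 ^ (3 * (n + 1))\<close> cells. This is the source of the word size; it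
  keeps address computations from wrapping around.\<close>

lemma limit_less: "limit < 2 ^ w"
proof -
  have "n * n \<le> 2 ^ n * 2 ^ n" by (intro mult_mono) (auto intro: less_imp_le)
  also have "\<dots> = 4 ^ n" by (simp flip: power_mult_distrib)
  finally have "n * n \<le> 4 ^ n" .
  moreover have "(2::nat) ^ n \<le> 4 ^ n" by (simp add: power_mono)
  moreover have "n < 2 ^ n" by simp
  moreover have "(0::nat) < 4 ^ n" by simp
  ultimately have "limit < 8 * 4 ^ n" unfolding limit_def base_def by linarith
  also have "\<dots> \<le> 8 * 8 ^ n" by (simp add: power_mono)
  also have "\<dots> = (2 ^ 3) ^ (n + 1)" by simp
  also have "\<dots> = 2 ^ (3 * (n + 1))" by (simp only: power_mult)
  also have "\<dots> \<le> 2 ^ w" using word_size by (intro power_increasing) auto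
  finally show ?thesis .
qed

lemma one_less: "1 < (2::nat) ^ w"
  using word_size by (intro one_less_power) auto

lemma base_le_limit: "base \<le> limit"
  by (simp add: limit_def)

lemma matrix_index: "u < n \<Longrightarrow> v < n \<Longrightarrow> u * n + v < n * n"
proof -
  assume "u < n" "v < n"
  then have "u * n + v < Suc u * n" by simp
  also have "\<dots> \<le> n * n" using \<open>u < n\<close> by (intro mult_right_mono) auto
  finally show ?thesis .
qed

definition static :: "config \<Rightarrow> bool" where
  "static s \<longleftrightarrow> reg s rN = n \<and> reg s rOne = 1 \<and> reg s rZero = 0 \<and> reg s rPow = n * n
     \<and> reg s rFlag = n * n + n"

definition tables :: "(nat \<Rightarrow> nat) \<Rightarrow> bool" where
  "tables M \<longleftrightarrow> (\<forall>u<n. \<forall>v<n. M (u * n + v) = of_bool (near E u v)) \<and> (\<forall>u<n. M (n * n + u) = 2 ^ u)"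

lemma tables_cong:
  assumes "tables M" "\<And>a. a < base \<Longrightarrow> M' a = M a"
  shows "tables M'"
proof -
  have "u * n + v < base" if "u < n" "v < n" for u v
    using matrix_index[OF that] by (simp add: base_def)
  then show ?thesis using assms by (simp add: tables_def base_def)
qed

section \<open>Correctness of the loops that branch on a task\<close>

lemma wp_deg_loop:
  assumes regs: "static s" "reg s rLen = length xs" "reg s rList = L" "reg s rRowU = u * n"
      "reg s rDeg = 0" "reg s rJ = 0"
    and mem: "tables (mem s)" "segment (mem s) L xs" "L + length xs \<le> limit"
    and xs: "set xs \<subseteq> {..<n}" and u: "u < n"
  shows "wp w deg_loop (\<lambda>t s'. t \<le> 8 * length xs + 2 \<and> mem s' = mem s \<and> out s' = out s \<and>
    reg s' rDeg = deg E xs u \<and> agree {rJ, rX, rA, rDeg, rTmp} s s') s"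
  unfolding deg_loop_def
proof (rule wp_for[where m = "length xs" and T = 6 and
      I = "\<lambda>j s'. reg s' rJ = j \<and> reg s' rDeg = length (filter (near E u) (take j xs)) \<and>
        mem s' = mem s \<and> out s' = out s \<and> agree {rJ, rX, rA, rDeg, rTmp} s s'"], goal_cases)
  case (2 j s')
  let ?x = "xs ! j"
  have x: "?x < n" using 2 xs nth_mem by blast
  have "length (filter (near E u) (take j xs)) \<le> j"
    by (rule order_trans[OF length_filter_le]) simp
  then have bounds: "length (filter (near E u) (take j xs)) + 1 < 2 ^ w" "L + j < 2 ^ w" "j + 1 < 2 ^ w"
    "u * n + ?x < 2 ^ w"
    using 2 mem(3) limit_less matrix_index[OF u x] by (auto simp: limit_def base_def)
  have "mem s (L + j) = ?x" "mem s (u * n + ?x) = of_bool (near E u ?x)"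
    using mem 2 u x by (auto simp: segment_nth tables_def)
  then show ?case
    using 2 regs bounds by (simp add: static_def take_Suc_conv_app_nth)
next
  case (4 t s')
  then show ?case using regs by (simp add: deg_def)
qed (use assms in \<open>auto simp: static_def\<close>)

lemma wp_min_loop:
  assumes regs: "static s" "reg s rLen = length xs" "reg s rList = L"
      "reg s rMin = length xs + 1" "reg s rI = 0"
    and mem: "tables (mem s)" "segment (mem s) L xs" "L + length xs \<le> limit"
    and xs: "set xs \<subseteq> {..<n}" "xs \<noteq> []"
  shows "wp w min_loop (\<lambda>t s'. t \<le> length xs * (8 * length xs + 13) + 2 \<and>
    mem s' = mem s \<and> out s' = out s \<and>
    reg s' rV \<in> set xs \<and> (\<forall>u\<in>set xs. deg E xs (reg s' rV) \<le> deg E xs u) \<and>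
    agree {rI, rJ, rX, rA, rDeg, rMin, rV, rU, rTmp, rRowU} s s') s"
  unfolding min_loop_def
\<comment> \<open>The initial minimum \<open>length xs + 1\<close> exceeds every closed degree, so
  the first vertex is always accepted and \<open>rV\<close> is meaningful once \<open>i > 0\<close>.
  Here \<open>T\<close> is \<open>5 + (8 * length xs + 2) + 3 + 1\<close>.\<close>
proof (rule wp_for[where m = "length xs" and T = "8 * length xs + 11" and
      I = "\<lambda>i s'. reg s' rI = i \<and> (\<forall>u\<in>set (take i xs). reg s' rMin \<le> deg E xs u) \<and>
        (if i = 0 then reg s' rMin = length xs + 1
         else reg s' rV \<in> set xs \<and> reg s' rMin = deg E xs (reg s' rV)) \<and>
        mem s' = mem s \<and> out s' = out s \<and>
        agree {rI, rJ, rX, rA, rDeg, rMin, rV, rU, rTmp, rRowU} s s'"], goal_cases)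
  case (2 i s')
  let ?u = "xs ! i"
  have u: "?u < n" "?u \<in> set xs" using 2 xs nth_mem by blast+
  have bounds: "L + i < 2 ^ w" "i + 1 < 2 ^ w" "?u * n < 2 ^ w"
    using 2 mem(3) limit_less matrix_index[OF u(1) u(1)] by (auto simp: limit_def base_def)
  have nth: "mem s (L + i) = ?u"
    using mem 2 by (auto simp: segment_nth)
  have less: "deg E xs ?u < length xs + 1" using deg_le[of E xs ?u] by simp
  show ?case
    using 2 regs bounds nth
    apply (simp add: static_def)
    apply (rule wp_mono[OF wp_deg_loop[where xs = xs and L = L and u = ?u]])
    using u mem xs less
    by (auto simp: static_def take_Suc_conv_app_nth split: if_splits)
next
  case (4 t s')
  then show ?case using xs by (auto simp: add.commute)
qed (use assms in \<open>auto simp: static_def\<close>)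

lemma wp_filter_loop:
  assumes regs: "static s" "reg s rLen = length xs" "reg s rList = L" "reg s rRowU = u * n"
      "reg s rCnt = 0" "reg s rPos = p" "reg s rJ = 0"
    and mem: "tables (mem s)" "segment (mem s) L xs" "L + length xs \<le> p" "base \<le> p"
    and xs: "set xs \<subseteq> {..<n}" and u: "u < n"
    and p: "p + length (filter (\<lambda>x. \<not> near E u x) xs) \<le> limit"
  shows "wp w filter_loop (\<lambda>t s'. t \<le> 11 * length xs + 2 \<and> out s' = out s \<and>
    segment (mem s') p (filter (\<lambda>x. \<not> near E u x) xs) \<and> (\<forall>a<p. mem s' a = mem s a) \<and>
    reg s' rCnt = length (filter (\<lambda>x. \<not> near E u x) xs) \<and>
    reg s' rPos = p + length (filter (\<lambda>x. \<not> near E u x) xs) \<and>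
    agree {rJ, rX, rA, rPos, rCnt, rTmp} s s') s"
  unfolding filter_loop_def
proof (rule wp_for[where m = "length xs" and T = 9 and
      I = "\<lambda>j s'. reg s' rJ = j \<and> out s' = out s \<and>
        segment (mem s') p (filter (\<lambda>x. \<not> near E u x) (take j xs)) \<and>
        (\<forall>a<p. mem s' a = mem s a) \<and>
        reg s' rCnt = length (filter (\<lambda>x. \<not> near E u x) (take j xs)) \<and>
        reg s' rPos = p + length (filter (\<lambda>x. \<not> near E u x) (take j xs)) \<and>
        agree {rJ, rX, rA, rPos, rCnt, rTmp} s s'"], goal_cases)
  case (2 j s')
  let ?x = "xs ! j" and ?f = "filter (\<lambda>x. \<not> near E u x)"
  have x: "?x < n" using 2 xs nth_mem by blast
  have take: "take (Suc j) xs = take j xs @ [?x]" using 2 by (simp add: take_Suc_conv_app_nth)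
  have "length (?f (take (Suc j) xs)) \<le> length (?f xs)"
    using append_take_drop_id[of "Suc j" xs] by (metis filter_append length_append le_add1)
  then have bounds: "\<not> near E u ?x \<Longrightarrow> p + length (?f (take j xs)) + 1 < 2 ^ w"
    "L + j < 2 ^ w" "j + 1 < 2 ^ w" "u * n + ?x < 2 ^ w"
    using 2 mem(3) p limit_less matrix_index[OF u x] by (auto simp: limit_def base_def take)
  \<comment> \<open>All cells read by the loop lie below \<open>p\<close>, where nothing is
    written.\<close>
  have "L + j < p" "u * n + ?x < p"
    using 2 mem(3,4) matrix_index[OF u x] by (auto simp: base_def)
  then have nth: "mem s' (L + j) = ?x" "mem s' (u * n + ?x) = of_bool (near E u ?x)"
    using mem 2 u x by (auto simp: segment_nth tables_def)
  show ?case
    using 2 regs bounds nth one_less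
    by (auto simp: static_def take segment_append segment_Cons elim!: segment_cong)
next
  case (4 t s')
  then show ?case using regs by simp
qed (use assms in \<open>auto simp: static_def\<close>)

lemma wp_push_child:
  assumes regs: "static s" "reg s rLen = length xs" "reg s rList = L" "reg s rU = u"
      "reg s rCode = c" "reg s rBudget = r" "reg s rTail = p"
    and mem: "tables (mem s)" "segment (mem s) L xs" "L + length xs \<le> p" "base \<le> p"
    and xs: "set xs \<subseteq> {..<n}" and u: "u < n"
    and r: "0 < r" "r < 2 ^ w" and c: "c + 2 ^ u < 2 ^ w"
    and p: "p + length (frame (child E (xs, c, r) u)) \<le> limit"
  shows "wp w push_child (\<lambda>t s'. t \<le> 11 * length xs + 18 \<and> out s' = out s \<and>
    segment (mem s') p (frame (child E (xs, c, r) u)) \<and> (\<forall>a<p. mem s' a = mem s a) \<and>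
    reg s' rTail = p + length (frame (child E (xs, c, r) u)) \<and>
    agree {rTail, rJ, rX, rA, rPos, rCnt, rTmp, rRowU} s s') s"
proof -
  let ?ys = "filter (\<lambda>x. \<not> near E u x) xs"
  have bounds: "u * n < 2 ^ w" "p + 3 < 2 ^ w" "n * n + u < p"
    using p limit_less mem(4) matrix_index[OF u u] u
    by (auto simp: limit_def base_def length_frame)
  \<comment> \<open>As the budget is positive, the modular subtraction gives the true
    predecessor.\<close>
  have dec: "(2 ^ w + r - Suc 0) mod 2 ^ w = r - Suc 0"
  proof -
    have "(2 ^ w + r - Suc 0) mod 2 ^ w = (2 ^ w + (r - Suc 0)) mod 2 ^ w" using r by simp
    also have "\<dots> = (r - Suc 0) mod 2 ^ w" by (rule mod_add_self1)
    finally show ?thesis using r by simp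
  qed
  have pow: "mem s (n * n + u) = 2 ^ u" using mem u by (simp add: tables_def)
  show ?thesis
    unfolding push_child_def
    using regs bounds one_less
    apply (simp add: static_def)
    \<comment> \<open>The offset 3 leaves room for the header of the frame.\<close>
    apply (rule wp_mono[OF wp_filter_loop[where xs = xs and L = L and u = u and p = "p + 3"]])
    using mem xs u p c r dec pow
    by (auto simp: static_def length_frame child_def segment_Cons eval_nat_numeral elim!: segment_cong)
qed

lemma wp_push_loop:
  assumes regs: "static s" "reg s rLen = length xs" "reg s rList = L" "reg s rRowV = v * n"
      "reg s rCode = c" "reg s rBudget = r" "reg s rTail = p" "reg s rI = 0"
    and mem: "tables (mem s)" "segment (mem s) L xs" "L + length xs \<le> p" "base \<le> p"
    and xs: "set xs \<subseteq> {..<n}" and v: "v < n"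
    and r: "0 < r" "r < 2 ^ w" and c: "\<And>u. u \<in> set xs \<Longrightarrow> c + 2 ^ u < 2 ^ w"
    and p: "p + length (frames (children E (xs, c, r) v)) \<le> limit"
  shows "wp w push_loop (\<lambda>t s'. t \<le> length xs * (11 * length xs + 26) + 2 \<and> out s' = out s \<and>
    segment (mem s') p (frames (children E (xs, c, r) v)) \<and> (\<forall>a<p. mem s' a = mem s a) \<and>
    reg s' rTail = p + length (frames (children E (xs, c, r) v)) \<and>
    agree {rTail, rI, rJ, rX, rA, rU, rPos, rCnt, rTmp, rRowU} s s') s"
proof -
  \<comment> \<open>\<open>fs i\<close> is what the first \<open>i\<close> iterations append. It is
    a prefix of the final result, so the space bound for the latter applies at every stage.\<close>
  define fs where "fs i = frames (map (child E (xs, c, r)) (filter (near E v) (take i xs)))" for i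
  have fs_all: "fs (length xs) = frames (children E (xs, c, r) v)"
    by (simp add: fs_def children_def)
  have fs_Suc: "fs (Suc i) = fs i @ (if near E v (xs ! i) then frame (child E (xs, c, r) (xs ! i)) else [])"
    if "i < length xs" for i
    using that by (simp add: fs_def take_Suc_conv_app_nth)
  have fs_0: "fs 0 = []" by (simp add: fs_def)
  have fs_le: "p + length (fs (Suc i)) \<le> limit" if "i < length xs" for i
  proof -
    have "fs (length xs) = fs (Suc i) @
        frames (map (child E (xs, c, r)) (filter (near E v) (drop (Suc i) xs)))"
      unfolding fs_def frames_simps(3)[symmetric] map_append[symmetric] filter_append[symmetric]
      by simp
    then show ?thesis using p unfolding fs_all[symmetric] by simp
  qed
  show ?thesis
    unfolding push_loop_def
  proof (rule wp_for[where m = "length xs" and T = "11 * length xs + 24" and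
        I = "\<lambda>i s'. reg s' rI = i \<and> out s' = out s \<and>
          segment (mem s') p (fs i) \<and> (\<forall>a<p. mem s' a = mem s a) \<and>
          reg s' rTail = p + length (fs i) \<and>
          agree {rTail, rI, rJ, rX, rA, rU, rPos, rCnt, rTmp, rRowU} s s'"], goal_cases)
    case (2 i s')
    let ?u = "xs ! i"
    have u: "?u < n" "?u \<in> set xs" using 2 xs nth_mem by blast+
    have "L + i < p" "v * n + ?u < p"
      using 2 mem(3,4) matrix_index[OF v u(1)] by (auto simp: base_def)
    then have nth: "mem s' (L + i) = ?u" "mem s' (v * n + ?u) = of_bool (near E v ?u)"
      using mem 2 u v by (auto simp: segment_nth tables_def)
    have bounds: "L + i < 2 ^ w" "i + 1 < 2 ^ w" "v * n + ?u < 2 ^ w"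
      using 2 mem(3) p limit_less matrix_index[OF v u(1)] by (auto simp: limit_def base_def)
    have segs: "segment (mem s') L xs" "tables (mem s')"
      using mem 2 by (auto elim!: segment_cong tables_cong)
    show ?case
    proof (cases "near E v ?u")
      case True
      have le: "p + length (fs i) + length (frame (child E (xs, c, r) ?u)) \<le> limit"
        using fs_le[OF 2(1)] fs_Suc[OF 2(1)] True by simp
      show ?thesis
        using 2 regs bounds nth True one_less
        apply (simp add: static_def)
        apply (rule wp_mono[OF wp_push_child[where xs = xs and L = L and u = ?u and c = c and r = r
              and p = "p + length (fs i)"]])
        using mem segs xs u r c le
        by (auto simp: static_def fs_Suc segment_append elim!: segment_cong)
    next
      case False
      then show ?thesis
        using 2 regs bounds nth by (simp add: static_def fs_Suc)
    qed
  next
    case (4 t s')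
    then show ?case using regs by (simp add: fs_all add.commute)
  qed (use assms in \<open>auto simp: static_def fs_0\<close>)
qed

section \<open>The queue invariant and the work at one task\<close>

fun valid :: "task \<Rightarrow> bool" where
  "valid (xs, c, r) \<longleftrightarrow> distinct xs \<and> set xs \<subseteq> {..<n} \<and> c + set_encode (set xs) < 2 ^ n \<and> r < 2 ^ w"

lemma set_encode_mono: "finite B \<Longrightarrow> A \<subseteq> B \<Longrightarrow> set_encode A \<le> set_encode B"
  by (simp add: set_encode_def sum_mono2)

text \<open>\<open>valid\<close> bounds the code reached by adding all remaining vertices. Moving
  \<open>u\<close> from the list to the code cannot raise that value, because \<open>u\<close> is
  itself filtered out.\<close>

lemma valid_child:
  assumes "valid (xs, c, r)" "u \<in> set xs"
  shows "valid (child E (xs, c, r) u)"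
proof -
  let ?A = "{x \<in> set xs. \<not> near E u x}"
  have "set_encode (insert u ?A) \<le> set_encode (set xs)"
    using assms by (intro set_encode_mono) auto
  then have "2 ^ u + set_encode ?A \<le> set_encode (set xs)" by simp
  with assms show ?thesis by (auto simp: child_def)
qed

lemma valid_code:
  assumes "valid (xs, c, r)" "u \<in> set xs"
  shows "c + 2 ^ u < 2 ^ w"
proof -
  have "set_encode {u} \<le> set_encode (set xs)" using assms by (intro set_encode_mono) auto
  then have "c + 2 ^ u < 2 ^ n" using assms by simp
  also have "(2::nat) ^ n \<le> 2 ^ w" using word_size by (intro power_increasing) auto
  finally show ?thesis .
qed

lemma length_frames_le: "length (frames ts) \<le> sum_list (map space ts)"
proof (induction ts)
  case (Cons t ts)
  have "m + 3 \<le> 4 * 4 ^ m" for m :: nat by (induction m) auto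
  from this[of "length (fst t)"] have "length (frame t) \<le> space t"
    by (simp add: length_frame space_def)
  with Cons show ?case by simp
qed simp

text \<open>The space condition accounts for the descendants of the waiting tasks too, so it
  survives branching although the head only moves forward.\<close>

definition inv :: "task list \<Rightarrow> nat list \<Rightarrow> config \<Rightarrow> bool" where
  "inv q ys s \<longleftrightarrow> static s \<and> tables (mem s) \<and> out s = ys \<and> distinct ys \<and>
     (\<forall>c<2 ^ n. mem s (n * n + n + c) = of_bool (c \<in> set ys)) \<and>
     base \<le> reg s rHead \<and> reg s rTail = reg s rHead + length (frames q) \<and>
     reg s rHead + sum_list (map space q) \<le> limit \<and> segment (mem s) (reg s rHead) (frames q) \<and>
     (\<forall>t\<in>set q. valid t)"

text \<open>All registers that the invariant mentions are numbered below 8.\<close>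

lemma inv_cong:
  assumes "inv q ys s" "mem s' = mem s" "out s' = out s" "\<And>r. r < 8 \<Longrightarrow> reg s' r = reg s r"
  shows "inv q ys s'"
  using assms by (simp add: inv_def static_def)

text \<open>The summand \<open>length xs + 3\<close> in the last assumption is the task's own frame,
  already passed by the head; \<open>space_children\<close> shows that the children fit into the
  rest.\<close>

lemma wp_branch:
  assumes regs: "static s" "reg s rLen = length xs" "reg s rList = L"
      "reg s rCode = c" "reg s rBudget = r" "reg s rTail = p"
    and mem: "tables (mem s)" "segment (mem s) L xs" "L + length xs \<le> p" "base \<le> p"
    and valid: "valid (xs, c, r)" and "xs \<noteq> []" and r: "0 < r"
    and p: "p + space (xs, c, r) \<le> limit + length xs + 3"
  shows "wp w branch (\<lambda>t s'. t \<le> 19 * (length xs)\<^sup>2 + 39 * length xs + 10 \<and> out s' = out s \<and>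
    reg s' rV \<in> set xs \<and> (\<forall>u\<in>set xs. deg E xs (reg s' rV) \<le> deg E xs u) \<and>
    segment (mem s') p (frames (children E (xs, c, r) (reg s' rV))) \<and>
    reg s' rTail = p + length (frames (children E (xs, c, r) (reg s' rV))) \<and>
    (\<forall>a<p. mem s' a = mem s a) \<and> static s' \<and> reg s' rHead = reg s rHead) s"
proof -
  have xs: "set xs \<subseteq> {..<n}" using valid by simp
  have fit: "p + length (frames (children E (xs, c, r) v)) \<le> limit"
    if "\<forall>u\<in>set xs. deg E xs v \<le> deg E xs u" for v
    using space_children[of xs E v c r] length_frames_le[of "children E (xs, c, r) v"] that p
    by simp
  have "m + 4 \<le> 4 * 4 ^ m" for m :: nat by (induction m) auto
  from this[of "length xs"] have le: "L + length xs \<le> limit" "length xs + 1 < 2 ^ w"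
    using p mem(3) limit_less by (simp_all add: space_def)
  have r_less: "r < 2 ^ w" using valid by simp
  have row: "v * n < 2 ^ w" if "v < n" for v
    using matrix_index[OF that that] limit_less by (simp add: limit_def base_def)
  show ?thesis
    unfolding branch_def
    using regs le
    apply (simp add: static_def)
    apply (rule wp_mono[OF wp_min_loop[where xs = xs and L = L]])
              using mem xs \<open>xs \<noteq> []\<close> le
              apply (auto simp: static_def)[10]
    subgoal premises prems for t s'
    proof -
      note row[of "reg s' rV"]
      have v: "reg s' rV < n" using prems xs by blast
      show ?thesis
        using prems row[OF v]
        apply (simp add: static_def)
        apply (rule wp_mono[OF wp_push_loop[where xs = xs and L = L and v = "reg s' rV"
              and c = c and r = r and p = p]])
        using mem xs r r_less v valid_code[OF valid] fit[of "reg s' rV"]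
        by (simp_all add: static_def power2_eq_square algebra_simps)
    qed
    done
qed

text \<open>Here \<open>ts\<close> are the new tasks and \<open>zs\<close> is the new output.
  Emitted codes together with pending solutions stay the same, the drop in space gives termination,
  and the drop in potential pays for the steps.\<close>

lemma wp_process:
  assumes inv: "inv ((xs, c, r) # q) ys s"
  shows "wp w process (\<lambda>t s'. t \<le> 40 * (length xs + 1)\<^sup>2 \<and> (\<exists>ts zs. inv (q @ ts) zs s' \<and>
    set zs \<union> \<Union> (solutions E ` set ts) = set ys \<union> solutions E (xs, c, r) \<and>
    sum_list (map space ts) < space (xs, c, r) \<and>
    (4 / 3) ^ length xs * (17 / 64) + sum_list (map potential ts) \<le> potential (xs, c, r))) s"
proof -
  define post where "post s' \<longleftrightarrow> (\<exists>ts zs. inv (q @ ts) zs s' \<and>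
      set zs \<union> \<Union> (solutions E ` set ts) = set ys \<union> solutions E (xs, c, r) \<and>
      sum_list (map space ts) < space (xs, c, r) \<and>
      (4 / 3) ^ length xs * (17 / 64) + sum_list (map potential ts) \<le> potential (xs, c, r))" for s'
  define h where "h = reg s rHead"
  have st: "static s" and tab: "tables (mem s)" and out: "out s = ys" "distinct ys"
    and flags: "\<And>c. c < 2 ^ n \<Longrightarrow> mem s (n * n + n + c) = of_bool (c \<in> set ys)"
    and h: "base \<le> h" and tail: "reg s rTail = h + (3 + length xs + length (frames q))"
    and fit: "h + (space (xs, c, r) + sum_list (map space q)) \<le> limit"
    and val: "valid (xs, c, r)" "\<And>t. t \<in> set q \<Longrightarrow> valid t"
    and seg0: "segment (mem s) h (frame (xs, c, r) @ frames q)"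
    using inv unfolding inv_def h_def by auto
  from seg0 have load: "mem s h = length xs" "mem s (Suc h) = c" "mem s (Suc (Suc h)) = r"
    and seg: "segment (mem s) (h + 3) xs" "segment (mem s) (h + 3 + length xs) (frames q)"
    by (simp_all add: segment_append segment_Cons eval_nat_numeral add.assoc)
  have len: "length (frames q) \<le> sum_list (map space q)" by (rule length_frames_le)
  have "m + 4 \<le> 4 * 4 ^ m" for m :: nat by (induction m) auto
  from this[of "length xs"] have sp: "length xs + 4 \<le> space (xs, c, r)" by (simp add: space_def)
  have bounds: "h + 3 + length xs < 2 ^ w" using sp fit limit_less by linarith
  have c: "c < 2 ^ n" using val by simp
  have flag_less: "n * n + n + c < base" using c by (simp add: base_def)
  then have flag_bound: "n * n + n + c < 2 ^ w" using base_le_limit limit_less by linarith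
  define s1 where "s1 = fold (exec_instr w)
    [Load rLen rHead, Arith Add rTmp rHead rOne, Load rCode rTmp,
       Arith Add rTmp rTmp rOne, Load rBudget rTmp, Arith Add rList rTmp rOne,
       Arith Add rHead rList rLen] s"
  have s1: "static s1" "reg s1 rLen = length xs" "reg s1 rList = h + 3" "reg s1 rCode = c"
    "reg s1 rBudget = r" "reg s1 rTail = reg s rTail" "reg s1 rHead = h + 3 + length xs"
    "mem s1 = mem s" "out s1 = ys"
  proof -
    have "reg s1 rList = Suc (Suc (Suc h)) \<and> reg s1 rHead = Suc (Suc (Suc (h + length xs)))"
      using st bounds load h_def[symmetric] by (simp add: s1_def static_def)
    then show "reg s1 rList = h + 3" "reg s1 rHead = h + 3 + length xs" by simp_all
  qed (use st bounds load out h_def[symmetric] in \<open>simp_all add: s1_def static_def\<close>)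
  have drop: "inv q ys s1"
    using s1 tab out flags h tail fit val(2) seg sp by (auto simp: inv_def)
  have main: "wp w (IfLess rZero rBudget (IfLess rZero rLen branch leaf) (Block []))
    (\<lambda>t s'. t + 7 \<le> 40 * (length xs + 1)\<^sup>2 \<and> post s') s1"
  proof -
    \<comment> \<open>Without new tasks, \<open>potential_ge\<close> alone pays for the
      work.\<close>
    have P_drop: "post s'" if "inv q zs s'" "set zs = set ys \<union> solutions E (xs, c, r)" for s' zs
      unfolding post_def
      using that sp potential_ge by (intro exI[of _ "[]"] exI[of _ zs]) (auto simp del: solutions.simps)
    \<comment> \<open>Budget 0 admits no set at all. On the empty graph only the empty set is left,
      so \<open>c\<close> is the single solution.\<close>
    consider "r = 0" | "r > 0" "xs = []" | "r > 0" "xs \<noteq> []" by auto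
    then show ?thesis
    proof cases
      case 1
      then show ?thesis
        using s1 P_drop[OF drop] by (simp add: static_def power2_eq_square)
    next
      case 2
      note sol = solutions_Nil[OF 2(1), of E c]
      show ?thesis
      proof (cases "c \<in> set ys")
        case True
        have "post s'" if "mem s' = mem s" "out s' = ys" "\<And>r. r < 8 \<Longrightarrow> reg s' r = reg s1 r" for s'
          using that s1 sol 2 True by (intro P_drop[where zs = ys] inv_cong[OF drop]) auto
        then show ?thesis
          using s1 2 flag_bound flags[OF c] True
          by (simp add: leaf_def static_def power2_eq_square)
      next
        case False
        have "inv q (ys @ [c]) s'"
          if s': "mem s' = (mem s)(n * n + n + c := 1)" "out s' = ys @ [c]"
            "\<And>r. r < 8 \<Longrightarrow> reg s' r = reg s1 r" for s'
        proof -
          \<comment> \<open>The flag cell lies above the matrix and the powers and below the queue,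
            so setting it disturbs neither.\<close>
          have "tables (mem s')"
            unfolding tables_def
          proof (intro conjI allI impI)
            fix u v assume "u < n" "v < n"
            with matrix_index[OF this] tab show "mem s' (u * n + v) = of_bool (near E u v)"
              by (simp add: s' tables_def)
          next
            fix u assume "u < n"
            with tab show "mem s' (n * n + u) = 2 ^ u" by (simp add: s' tables_def)
          qed
          moreover have "segment (mem s') (reg s1 rHead) (frames q)"
            using seg(2) s1 s' h flag_less by (auto elim!: segment_cong)
          ultimately show ?thesis
            using drop False out flags s1(8) by (auto simp: inv_def s' static_def)
        qed
        then have "post s'"
          if "mem s' = (mem s)(n * n + n + c := 1)" "out s' = ys @ [c]"
            "\<And>r. r < 8 \<Longrightarrow> reg s' r = reg s1 r" for s'
          using that sol 2 by (intro P_drop[where zs = "ys @ [c]"]) auto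
        then show ?thesis
          using s1 2 flag_bound flags[OF c] False
          by (simp add: leaf_def static_def power2_eq_square)
      qed
    next
      case 3
      have P_branch: "post s'"
        if "v \<in> set xs" "\<forall>u\<in>set xs. deg E xs v \<le> deg E xs u" "out s' = ys"
          "segment (mem s') (reg s rTail) (frames (children E (xs, c, r) v))"
          "reg s' rTail = reg s rTail + length (frames (children E (xs, c, r) v))"
          "\<forall>a<reg s rTail. mem s' a = mem s a" "static s'" "reg s' rHead = reg s1 rHead" for s' v
        unfolding post_def
      proof (intro exI conjI)
        let ?ts = "children E (xs, c, r) v"
        have sc: "length xs + 3 + sum_list (map space ?ts) \<le> space (xs, c, r)"
          using that by (intro space_children) auto
        show "inv (q @ ?ts) ys s'"
          unfolding inv_def
        proof (intro conjI)
          show "tables (mem s')" using tab by (rule tables_cong) (use that h tail in auto)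
          show "\<forall>c<2 ^ n. mem s' (n * n + n + c) = of_bool (c \<in> set ys)"
            using that h tail flags by (auto simp: base_def)
          show "segment (mem s') (reg s' rHead) (frames (q @ ?ts))"
            using that s1 seg tail by (auto simp: segment_append add.assoc elim!: segment_cong)
          show "\<forall>t\<in>set (q @ ?ts). valid t"
            using val valid_child[OF val(1)] by (auto simp: children_def)
        qed (use that s1 out h tail fit sc in auto)
        show "set ys \<union> \<Union> (solutions E ` set ?ts) = set ys \<union> solutions E (xs, c, r)"
          using solutions_children[OF that(1) \<open>r > 0\<close>] by simp
        show "sum_list (map space ?ts) < space (xs, c, r)" using sc by simp
        show "(4 / 3) ^ length xs * (17 / 64) + sum_list (map potential ?ts) \<le> potential (xs, c, r)"
          using that \<open>r > 0\<close> by (intro potential_children) auto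
      qed
      have pre: "tables (mem s1)" "segment (mem s1) (h + 3) xs" "h + 3 + length xs \<le> reg s rTail"
        "base \<le> reg s rTail" "reg s rTail + space (xs, c, r) \<le> limit + length xs + 3"
        using s1 tab seg(1) h tail fit len by simp_all
      \<comment> \<open>The 9 steps are the seven instructions that fetch the task and the two
        successful comparisons.\<close>
      have "wp w branch (\<lambda>t s'. 9 + t \<le> 40 * (length xs + 1)\<^sup>2 \<and> post s') s1"
      proof (rule wp_mono[OF wp_branch[OF s1(1-6) pre(1-4) val(1) 3(2,1) pre(5)]], goal_cases)
        case (1 t s')
        then show ?case
          using P_branch[of "reg s' rV" s'] s1 by (simp add: power2_eq_square algebra_simps)
      qed
      with 3 show ?thesis using s1 by (simp add: static_def)
    qed
  qed
  show ?thesis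
    unfolding process_def post_def[symmetric] wp_Seq wp_Block s1_def[symmetric]
    by (intro conjI wp_mono[OF main]) simp_all
qed

text \<open>The induction is on the total space of the waiting tasks, which drops even when children
  are appended.\<close>

lemma wp_process_queue:
  assumes "inv q ys s"
  shows "wp w (WhileLess rHead rTail process) (\<lambda>t s'.
    real t \<le> 1500 * sum_list (map potential q) + 2 \<and> distinct (out s') \<and>
    set (out s') = set ys \<union> \<Union> (solutions E ` set q)) s"
  using assms
proof (induction "sum_list (map space q)" arbitrary: q ys s rule: less_induct)
  case less
  show ?case
  proof (cases q)
    case Nil
    with less.prems show ?thesis by (intro wp_WhileLess_False) (auto simp: inv_def)
  next
    case (Cons task q')
    obtain xs c r where task: "task = (xs, c, r)" by (cases task)
    note inv = less.prems[unfolded Cons task]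
    \<comment> \<open>The added 2 is the loop overhead. The constant 1500 works because
      \<open>42 * 9 = 378\<close> while \<open>1500 * 17 / 64\<close> exceeds 398.\<close>
    have "real (40 * (length xs + 1)\<^sup>2 + 2) \<le> 42 * (real (length xs) + 1)\<^sup>2"
      by (simp add: power2_eq_square algebra_simps)
    also have "\<dots> \<le> 1500 * ((4 / 3) ^ length xs * (17 / 64))"
      using square_le_power[of "length xs"] zero_le_power[of "4 / 3 :: real" "length xs"] by linarith
    finally have cost: "real (40 * (length xs + 1)\<^sup>2 + 2) \<le> 1500 * ((4 / 3) ^ length xs * (17 / 64))" .
    show ?thesis
    proof (rule wp_WhileLess_True)
      show "reg s rHead < reg s rTail" using inv by (simp add: inv_def)
      show "wp w process (\<lambda>t. wp w (WhileLess rHead rTail process) (\<lambda>t' s'.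
        real (t + t' + 2) \<le> 1500 * sum_list (map potential q) + 2 \<and> distinct (out s') \<and>
        set (out s') = set ys \<union> \<Union> (solutions E ` set q))) s"
      proof (rule wp_mono[OF wp_process[OF inv]], elim conjE exE, goal_cases)
        case (1 t s' ts zs)
        have "sum_list (map space (q' @ ts)) < sum_list (map space q)"
          using 1 by (simp add: Cons task)
        from less.hyps[OF this 1(2)] show ?case
        proof (rule wp_mono, goal_cases)
          case (1 t' s'')
          have "real t \<le> real (40 * (length xs + 1)\<^sup>2)"
            using \<open>t \<le> _\<close> by (rule of_nat_mono)
          then have "real (t + t' + 2) \<le> 1500 * sum_list (map potential q) + 2"
            using 1 cost \<open>_ \<le> potential _\<close> by (simp add: Cons task del: of_nat_mult of_nat_power)
          then show ?case
            using 1 \<open>set zs \<union> _ = _\<close> by (auto simp: Cons task simp del: solutions.simps)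
        qed
      qed
    qed
  qed
qed

section \<open>Initialisation and the total running time\<close>

lemma wp_table_loop:
  assumes graph: "simple_graph n E"
    and regs: "static s" "reg s rX = 1" "reg s rI = 0" and mem: "mem s = mem (input_config n E k)"
  shows "wp w table_loop (\<lambda>t s'. t \<le> 9 * n + 2 \<and> out s' = out s \<and> tables (mem s') \<and>
    (\<forall>a\<ge>n * n + n. mem s' a = 0) \<and> reg s' rX = 2 ^ n \<and> agree {rI, rX, rTmp} s s') s"
  unfolding table_loop_def
\<comment> \<open>After \<open>i\<close> iterations the first \<open>i\<close> diagonal entries and
  powers are in place. The cells above the power table remain zero, which supplies the cleared
  flags.\<close>
proof (rule wp_for[where m = n and T = 7 and
      I = "\<lambda>i s'. reg s' rI = i \<and> out s' = out s \<and> reg s' rX = 2 ^ i \<and>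
        (\<forall>u<n. \<forall>v<n. mem s' (u * n + v) = of_bool ({u, v} \<in> E \<or> u = v \<and> u < i)) \<and>
        (\<forall>u<i. mem s' (n * n + u) = 2 ^ u) \<and> (\<forall>a\<ge>n * n + n. mem s' a = 0) \<and>
        agree {rI, rX, rTmp} s s'"], goal_cases)
  case 1
  have "mem s (u * n + v) = of_bool ({u, v} \<in> E)" if "u < n" "v < n" for u v
    using matrix_index[OF that] that by (simp add: mem input_config_def)
  with regs show ?case by (simp add: mem input_config_def)
next
  case (2 i s')
  \<comment> \<open>Even the last doubling, which gives \<open>2 ^ n\<close>, must not wrap
    around.\<close>
  have "(2::nat) ^ Suc i \<le> 2 ^ n" using 2 by (intro power_increasing) auto
  then have bounds: "2 ^ i + 2 ^ i < (2::nat) ^ w" "n * n + i < 2 ^ w" "i + 1 < 2 ^ w"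
    "i * n + i < 2 ^ w" "i * n < 2 ^ w"
    using 2 matrix_index[of i i] limit_less by (auto simp: limit_def base_def)
  have idx: "i * n + i < n * n" "\<And>u v. u < n \<Longrightarrow> v < n \<Longrightarrow> u * n + v < n * n"
    using 2 matrix_index by blast+
  have eq: "u * n + v = i * n + i \<longleftrightarrow> u = i \<and> v = i" if "v < n" for u v
    using index_eq_iff[OF that] 2 by blast
  have ne: "u * n + v \<noteq> n * n + i" if "u < n" "v < n" for u v
    using idx(2)[OF that] by simp
  define M where "M = (mem s')(i * n + i := Suc 0, n * n + i := 2 ^ i)"
  have "M (u * n + v) = of_bool ({u, v} \<in> E \<or> u = v \<and> u < Suc i)" if "u < n" "v < n" for u v
    using 2 that ne[OF that] by (auto simp: M_def eq less_Suc_eq)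
  moreover have "M (n * n + u) = 2 ^ u" if "u < Suc i" for u
    using 2 that idx(1) by (auto simp: M_def less_Suc_eq)
  moreover have "M a = 0" if "a \<ge> n * n + n" for a
    using 2 that idx(1) by (simp add: M_def)
  ultimately show ?case
    using 2 regs bounds by (simp add: static_def flip: M_def)
next
  case (4 t s')
  have "{u} \<notin> E" for u using graph by (fastforce simp: simple_graph_def doubleton_eq_iff)
  then show ?case using 4 by (auto simp: tables_def near_def)
qed (use regs in \<open>auto simp: static_def\<close>)

lemma wp_list_loop:
  assumes regs: "static s" "reg s rTail = p" "reg s rI = 0" and p: "p + n < 2 ^ w"
  shows "wp w list_loop (\<lambda>t s'. t \<le> 5 * n + 2 \<and> out s' = out s \<and>
    segment (mem s') p [0..<n] \<and> (\<forall>a<p. mem s' a = mem s a) \<and> reg s' rTail = p + n \<and>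
    agree {rI, rTail} s s') s"
  unfolding list_loop_def
proof (rule wp_for[where m = n and T = 3 and
      I = "\<lambda>i s'. reg s' rI = i \<and> out s' = out s \<and> segment (mem s') p [0..<i] \<and>
        (\<forall>a<p. mem s' a = mem s a) \<and> reg s' rTail = p + i \<and> agree {rI, rTail} s s'"], goal_cases)
  case (2 i s')
  then show ?case
    using regs p by (auto simp: static_def segment_append segment_Cons elim!: segment_cong)
qed (use regs in \<open>auto simp: static_def\<close>)

lemma wp_prepare:
  assumes graph: "simple_graph n E" and k: "k < 2 ^ w"
  shows "wp w prepare (\<lambda>t s'. t \<le> 14 * n + 16 \<and> inv [([0..<n], 0, k)] [] s') (input_config n E k)"
proof -
  have square: "n * n + n + 2 ^ n < 2 ^ w" "n * n + n < 2 ^ w" "n * n < 2 ^ w"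
    using base_le_limit limit_less by (auto simp: base_def)
  have "m + 4 \<le> 4 * 4 ^ m" for m :: nat by (induction m) auto
  from this[of n] have base: "base + 3 + n < 2 ^ w" using limit_less by (simp add: limit_def)
  \<comment> \<open>The root has code 0 and all vertices left, so its largest reachable code is the
    largest \<open>n\<close>-bit number.\<close>
  have "set_encode {0..<n} = 2 ^ n - 1" by (simp add: set_encode_def sum_power2)
  then have enc: "set_encode {0..<n} < 2 ^ n" by simp
  define s1 where "s1 = fold (exec_instr w)
    [Const rOne 1, Arith Mult rPow rN rN, Arith Add rFlag rPow rN, Const rX 1] (input_config n E k)"
  have s1: "static s1" "reg s1 rX = 1" "reg s1 rI = 0" "mem s1 = mem (input_config n E k)"
    "reg s1 rK = k" "out s1 = []"
    using square one_less word_size by (simp_all add: s1_def static_def input_config_def)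
  have rest: "wp w enqueue_root
      (\<lambda>t s'. t \<le> 5 * n + 10 \<and> inv [([0..<n], 0, k)] [] s') s2"
    if s2: "static s2" "tables (mem s2)" "\<forall>a\<ge>n * n + n. mem s2 a = 0" "reg s2 rX = 2 ^ n"
      "reg s2 rK = k" "out s2 = []" for s2
  proof -
    define s3 where "s3 = fold (exec_instr w)
      [Arith Add rHead rFlag rX, Store rHead rN,
       Arith Add rTmp rHead rOne, Store rTmp rZero,
       Arith Add rTmp rTmp rOne, Store rTmp rK,
       Arith Add rTail rTmp rOne, Const rI 0] s2"
    have mem3: "mem s3 = (mem s2)(base := n, Suc base := 0, Suc (Suc base) := k)"
      and s3: "static s3" "reg s3 rHead = base" "reg s3 rI = 0" "out s3 = []"
      using s2 square base by (simp_all add: s3_def static_def flip: base_def)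
    have "reg s3 rTail = Suc (Suc (Suc base))"
      using s2 square base by (simp add: s3_def static_def flip: base_def)
    then have tail: "reg s3 rTail = base + 3" by simp
    have "wp w list_loop (\<lambda>t s'. t + 8 \<le> 5 * n + 10 \<and> inv [([0..<n], 0, k)] [] s') s3"
    proof (rule wp_mono[OF wp_list_loop[OF s3(1) tail s3(3) base]], goal_cases)
      case (1 t s')
      have below: "mem s' a = mem s2 a" if "a < base" for a
        using 1 that by (simp add: mem3)
      have "tables (mem s')" using s2(2) below by (rule tables_cong)
      moreover have "segment (mem s') base (frames [([0..<n], 0, k)])"
        using 1 by (simp add: mem3 segment_Cons eval_nat_numeral)
      \<comment> \<open>The cleared flags match the empty output.\<close>
      moreover have "mem s' (n * n + n + c) = 0" if "c < 2 ^ n" for c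
        using that s2(3) below[of "n * n + n + c"] by (simp add: base_def)
      ultimately show ?case
        using 1 s3 tail enc k
        by (auto simp: inv_def static_def space_def limit_def)
    qed
    then show ?thesis
      unfolding enqueue_root_def wp_Seq wp_Block s3_def[symmetric]
      by (auto simp: add.commute elim!: wp_mono)
  qed
  show ?thesis
    unfolding prepare_def wp_Seq wp_Block s1_def[symmetric]
  proof (intro conjI, simp, rule wp_mono[OF wp_table_loop[OF graph s1(1-4)]], goal_cases)
    case (1 t s2)
    then have "wp w enqueue_root (\<lambda>t s'. t \<le> 5 * n + 10 \<and> inv [([0..<n], 0, k)] [] s') s2"
      using s1 by (intro rest) (simp_all add: static_def)
    then show ?case by (rule wp_mono) (use 1 in simp)
  qed
qed

lemma solutions_initial:
  "solutions E ([0..<n], 0, k) = set_encode ` {I. maximal_independent_set n E I \<and> card I < k}"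
  by (auto simp: maximal_independent_set_iff_mis atLeast0LessThan)

lemma wp_main:
  assumes "simple_graph n E" "k < 2 ^ w"
  shows "wp w main (\<lambda>t s'. real t \<le> 2200 * ((4 / 3) ^ n * (81 / 64) ^ k) \<and>
    enumerates (out s') {I. maximal_independent_set n E I \<and> card I < k}) (input_config n E k)"
  unfolding main_def wp_Seq
proof (rule wp_mono[OF wp_prepare[OF assms]], elim conjE, goal_cases)
  case (1 t s)
  let ?a = "(4 / 3 :: real) ^ n" and ?q = "(81 / 64 :: real) ^ k"
  have aq: "1 \<le> ?q" "1 \<le> ?a" by (simp_all add: one_le_power)
  then have "1 \<le> ?a * ?q" "?a \<le> ?a * ?q"
    using mult_mono[of 1 ?a 1 ?q] mult_left_mono[of 1 ?q ?a] by simp_all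
  have "real t \<le> real (14 * n + 16)" using 1(1) by (rule of_nat_mono)
  also have "\<dots> \<le> 16 * (real n + 1)\<^sup>2" by (simp add: power2_eq_square algebra_simps)
  also have "\<dots> \<le> 144 * ?a" using square_le_power[of n] by simp
  finally have t: "real t \<le> 144 * ?a" .
  have "potential ([0..<n], 0, k) \<le> 81 / 64 * (?a * ?q)"
    by (simp add: potential_def algebra_simps)
  show ?case
  proof (rule wp_mono[OF wp_process_queue[OF 1(2)]], goal_cases)
    case (1 t' s')
    then have "real t' \<le> 1500 * potential ([0..<n], 0, k) + 2" by simp
    \<comment> \<open>\<open>1500 * 81 / 64\<close> is below 1899; the preparation adds 144 and the
      exit from the main loop 2, which stays below 2200.\<close>
    then have "real (t + t') \<le> 2200 * (?a * ?q)"
      unfolding of_nat_add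
      using t \<open>1 \<le> ?a * ?q\<close> \<open>?a \<le> ?a * ?q\<close> \<open>potential _ \<le> _\<close> by linarith
    with 1 show ?case by (simp add: enumerates_def solutions_initial del: solutions.simps)
  qed
qed

end

theorem theorem2:
  "\<exists>(P :: instr list) (b :: nat) (C :: real). \<forall>(n :: nat) (E :: nat set set) (k :: nat) (w :: nat).
     simple_graph n E \<and> b * (n + 1) \<le> w \<and> k < 2 ^ w \<longrightarrow>
     (\<exists>t. real t \<le> C * (3 powr (4 * real k - real n) * 4 powr (real n - 3 * real k)) \<and>
          halted P (run w P t (input_config n E k)) \<and>
          enumerates (out (run w P t (input_config n E k)))
            {I. maximal_independent_set n E I \<and> card I < k})"
proof (rule exI[of _ "compile 0 main"], rule exI[of _ 3], rule exI[of _ 2200], intro allI impI, elim conjE)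
  fix n k w :: nat and E
  let ?P = "compile 0 main" and ?s = "input_config n E k"
  assume *: "simple_graph n E" "3 * (n + 1) \<le> w" "k < 2 ^ w"
  interpret word_ram n w E by unfold_locales (rule *)
  obtain t s where exec: "exec w main ?s t s"
    and t: "real t \<le> 2200 * ((4 / 3) ^ n * (81 / 64) ^ k)"
    and s: "enumerates (out s) {I. maximal_independent_set n E I \<and> card I < k}"
    using wp_main[OF *(1,3)] unfolding wp_def by blast
  \<comment> \<open>The input starts at address 0, where the compiled program begins. The run ends
    with the counter just behind the program, which is a halted configuration.\<close>
  have "?s = ?s\<lparr>pc := 0\<rparr>" by (simp add: input_config_def)
  moreover have "code_at ?P 0 ?P" by (simp add: code_at_def)
  ultimately have "run w ?P t ?s = s\<lparr>pc := length ?P\<rparr>"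
    using run_compile[OF exec, of ?P 0] by simp
  with t s show "\<exists>t. real t \<le> 2200 * (3 powr (4 * real k - real n) * 4 powr (real n - 3 * real k)) \<and>
      halted ?P (run w ?P t ?s) \<and>
      enumerates (out (run w ?P t ?s)) {I. maximal_independent_set n E I \<and> card I < k}"
    by (intro exI[of _ t]) (simp add: halted_def bound_eq)
qed

end
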